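(* Let $d\ge 1$ and let $\mathbf{s}=(s_1,\ldots,s_d)$ be a sequence of positive integers such that $s_i\le s_{i+1}$ and $0\le s_{i+1}-s_i\le 1$ for all $1\le i\le d-1$. Suppose that $\mathbf{P}_d^{(\mathbf{s})}$ is translation equivalent to a Fano polytope. Then $\mathbf{P}_d^{(\mathbf{s})}$ is reflexive up to translation if and only if for all $1\le i\le d-1$ one has $k_i\mid s_i$ and $k_i\mid s_{i+1}$, where $k_i=(i+1)s_i-i\,s_{i+1}$.
   Context: For a sequence of positive integers $\mathbf{s}=(s_1,\ldots,s_d)$, the $\mathbf{s}$-lecture hall polytope is $\mathbf{P}_d^{(\mathbf{s})}=\{\mathbf{x}\in\mathbb{R}^d : 0\le \frac{x_1}{s_1}\le\frac{x_2}{s_2}\le\cdots\le\frac{x_d}{s_d}\le 1\}$, a $d$-dimensional lattice polytope. A $d$-dimensional lattice polytope $\mathcal{P}\subset\mathbb{R}^d$ is Fano if $(\mathcal{P}\setminus\partial\mathcal{P})\cap\mathbb{Z}^d=\{\mathbf{0}\}$. It is reflexive if it is Fano and its dual polytope $\mathcal{P}^\vee=\{y\in\mathbb{R}^d : \langle x,y\rangle\le 1 \text{ for all } x\in\mathcal{P}\}$ is a lattice polytope. Two lattice polytopes are translation equivalent if one is the translate of the other by a vector in $\mathbb{Z}^d$; "reflexive up to translation" means translation equivalent to a reflexive polytope. *)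

theory Defs
  imports "HOL-Analysis.Analysis"
begin

definition integer_lattice :: "(real^'n) set" where
  "integer_lattice = {x. \<forall>i. x $ i \<in> \<int>}"

definition lattice_polytope :: "(real^'n) set \<Rightarrow> bool" where
  "lattice_polytope P \<longleftrightarrow> (\<exists>V. finite V \<and> V \<subseteq> integer_lattice \<and> P = convex hull V)"

definition fano :: "(real^'n) set \<Rightarrow> bool" where
  "fano P \<longleftrightarrow> lattice_polytope P \<and> aff_dim P = int CARD('n) \<and>
     (P - frontier P) \<inter> integer_lattice = {0}"

definition dual_polytope :: "(real^'n) set \<Rightarrow> (real^'n) set" where
  "dual_polytope P = {y. \<forall>x\<in>P. x \<bullet> y \<le> 1}"

definition reflexive :: "(real^'n) set \<Rightarrow> bool" where
  "reflexive P \<longleftrightarrow> fano P \<and> lattice_polytope (dual_polytope P)"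

definition translation_equivalent :: "(real^'n) set \<Rightarrow> (real^'n) set \<Rightarrow> bool" where
  "translation_equivalent P Q \<longleftrightarrow> (\<exists>v\<in>integer_lattice. Q = (+) v ` P)"

definition reflexive_up_to_translation :: "(real^'n) set \<Rightarrow> bool" where
  "reflexive_up_to_translation P \<longleftrightarrow> (\<exists>Q. reflexive Q \<and> translation_equivalent P Q)"

text \<open>
  The dimension is \<open>d = CARD('n)\<close>. The coordinates of a vector are numbered \<open>1, \<dots>, d\<close>
  in increasing order of the index type, so \<open>coord x i\<close> is the usual $x_i$; it is
  only meaningful for \<open>1 \<le> i \<le> d\<close>.
\<close>

definition nth_index :: "nat \<Rightarrow> 'n::{finite,linorder}" where
  "nth_index i = sorted_list_of_set UNIV ! (i - 1)"

definition coord :: "real^'n::{finite,linorder} \<Rightarrow> nat \<Rightarrow> real" where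
  "coord x i = x $ nth_index i"

lemma bij_betw_nth_index:
  "bij_betw (nth_index :: nat \<Rightarrow> 'n::{finite,linorder}) {1..CARD('n)} UNIV"
proof -
  let ?xs = "sorted_list_of_set (UNIV :: 'n set)"
  have "bij_betw ((!) ?xs) {..<CARD('n)} UNIV"
    by (rule bij_betw_nth) auto
  moreover have "bij_betw (\<lambda>i. i - 1) {1..CARD('n)} {..<CARD('n)}"
    by (rule bij_betw_byWitness[where f' = Suc]) auto
  ultimately have "bij_betw ((!) ?xs \<circ> (\<lambda>i. i - 1)) {1..CARD('n)} UNIV"
    by (rule bij_betw_trans[rotated])
  moreover have "(!) ?xs \<circ> (\<lambda>i. i - 1) = nth_index"
    by (simp add: fun_eq_iff nth_index_def)
  ultimately show ?thesis by simp
qed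

text \<open>Only the values \<open>s 1, \<dots>, s d\<close> of the sequence matter.\<close>

definition lecture_hall_polytope :: "(nat \<Rightarrow> int) \<Rightarrow> (real^'n::{finite,linorder}) set" where
  "lecture_hall_polytope s =
     {x. 0 \<le> coord x 1 / of_int (s 1) \<and>
         (\<forall>i\<in>{1..<CARD('n)}.
            coord x i / of_int (s i) \<le> coord x (i + 1) / of_int (s (i + 1))) \<and>
         coord x CARD('n) / of_int (s CARD('n)) \<le> 1}"

end

theory Submission
  imports Defs
begin

text \<open>
  An interior lattice point \<open>u\<close> of the polytope satisfies \<open>i \<le> u\<^sub>i < s\<^sub>i\<close>, which makes
  \<open>w = (1, \<dots>, d)\<close> interior as well; so \<open>w\<close> is the only one, and \<open>(1, \<dots>, d - 1, d + 1)\<close> not being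
  interior forces \<open>s\<^sub>d = d + 1\<close>. The translate by \<open>-w\<close> is then cut out by the inequalities
  \<open>b\<^sub>j \<bullet> y \<le> 1\<close> for \<open>0 \<le> j \<le> d\<close>, with \<open>b\<^sub>0 = - e\<^sub>1\<close>, \<open>b\<^sub>d = e\<^sub>d\<close> and
  \<open>b\<^sub>i = (s\<^sub>i\<^sub>+\<^sub>1 e\<^sub>i - s\<^sub>i e\<^sub>i\<^sub>+\<^sub>1) / k\<^sub>i\<close> otherwise. Its dual is the convex hull of \<open>0\<close> and the \<open>b\<^sub>j\<close>, and each
  \<open>b\<^sub>i\<close> with \<open>0 < i < d\<close> is a vertex of it. So the dual is a lattice polytope iff these \<open>b\<^sub>i\<close> are integral.
\<close>

section \<open>Halfspaces, polarity and lattice vertices of the dual\<close>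

lemma of_int_divide_in_Ints_iff:
  assumes "b \<noteq> 0"
  shows "(of_int a / of_int b :: 'a::field_char_0) \<in> \<int> \<longleftrightarrow> b dvd a"
proof
  assume "(of_int a / of_int b :: 'a) \<in> \<int>"
  then obtain c where "(of_int a / of_int b :: 'a) = of_int c"
    by (auto elim: Ints_cases)
  then have "(of_int a :: 'a) = of_int (c * b)"
    using assms by (simp add: field_simps)
  then show "b dvd a"
    by (simp only: of_int_eq_iff) simp
next
  assume "b dvd a"
  then show "(of_int a / of_int b :: 'a) \<in> \<int>"
    using assms by (auto elim!: dvdE)
qed

lemma interior_finite_Inter_halfspaces:
  fixes a :: "'i \<Rightarrow> 'a::euclidean_space"
  assumes "finite I" "\<And>i. i \<in> I \<Longrightarrow> a i \<noteq> 0"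
  shows "interior {x. \<forall>i\<in>I. a i \<bullet> x \<le> b i} = {x. \<forall>i\<in>I. a i \<bullet> x < b i}"
proof
  show "interior {x. \<forall>i\<in>I. a i \<bullet> x \<le> b i} \<subseteq> {x. \<forall>i\<in>I. a i \<bullet> x < b i}"
  proof safe
    fix x i
    assume x: "x \<in> interior {x. \<forall>i\<in>I. a i \<bullet> x \<le> b i}" and i: "i \<in> I"
    have "x \<in> interior {x. a i \<bullet> x \<le> b i}"
      using i by (intro subsetD[OF interior_mono x]) auto
    then show "a i \<bullet> x < b i"
      using assms(2)[OF i] by (simp add: interior_halfspace_le)
  qed
  have "open (\<Inter>i\<in>I. {x. a i \<bullet> x < b i})"
    using assms(1) by (intro open_INT) (auto intro: open_halfspace_lt)
  also have "(\<Inter>i\<in>I. {x. a i \<bullet> x < b i}) = {x. \<forall>i\<in>I. a i \<bullet> x < b i}"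
    by auto
  finally show "{x. \<forall>i\<in>I. a i \<bullet> x < b i} \<subseteq> interior {x. \<forall>i\<in>I. a i \<bullet> x \<le> b i}"
    by (intro interior_maximal) (auto intro: less_imp_le)
qed

text \<open>Polarity by separation. A point \<open>z\<close> outside the compact hull satisfies
  \<open>a \<bullet> z < c\<close> for some \<open>a\<close>, while \<open>a\<close> exceeds
  \<open>c\<close> on the hull. As \<open>0\<close> lies in the hull, \<open>c\<close> is negative,
  so dividing by \<open>c\<close> reverses both inequalities: \<open>a /\<^sub>R c\<close> satisfies
  every halfspace but has product greater than 1 with \<open>z\<close>.\<close>

lemma dual_polytope_halfspaces:
  fixes B :: "(real^'n) set"
  assumes "finite B"
  shows "dual_polytope {y. \<forall>b\<in>B. b \<bullet> y \<le> 1} = convex hull (insert 0 B)"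
proof
  have "convex (dual_polytope {y. \<forall>b\<in>B. b \<bullet> y \<le> 1})"
    unfolding dual_polytope_def Collect_ball_eq
    by (intro convex_INT ballI) (auto intro: convex_halfspace_le)
  then show "convex hull (insert 0 B) \<subseteq> dual_polytope {y. \<forall>b\<in>B. b \<bullet> y \<le> 1}"
    by (intro hull_minimal) (auto simp: dual_polytope_def inner_commute)
  show "dual_polytope {y. \<forall>b\<in>B. b \<bullet> y \<le> 1} \<subseteq> convex hull (insert 0 B)"
  proof (rule subsetI, rule ccontr)
    fix z
    assume z: "z \<in> dual_polytope {y. \<forall>b\<in>B. b \<bullet> y \<le> 1}" and "z \<notin> convex hull (insert 0 B)"
    moreover have "closed (convex hull (insert 0 B))"
      using assms by (intro compact_imp_closed compact_convex_hull finite_imp_compact) simp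
    ultimately obtain a c where a: "a \<bullet> z < c" "\<And>x. x \<in> convex hull (insert 0 B) \<Longrightarrow> c < a \<bullet> x"
      using separating_hyperplane_closed_point[OF convex_convex_hull] by blast
    have c: "c < 0"
      using a(2)[of 0] by (simp add: hull_inc)
    have "b \<bullet> (a /\<^sub>R c) \<le> 1" if "b \<in> B" for b
      using a(2)[of b] that c by (simp add: hull_inc inner_commute field_simps)
    then have "(a /\<^sub>R c) \<bullet> z \<le> 1"
      using z unfolding dual_polytope_def by blast
    then show False
      using a(1) c by (simp add: field_simps)
  qed
qed

text \<open>The point \<open>y\<close> makes only the inequality of \<open>b\<close> tight, so the
  functional given by \<open>y\<close> is 1 at \<open>b\<close> and below 1 at \<open>0\<close> and
  at all other generators of the dual. Hence \<open>b\<close> is a vertex of the dual, and every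
  finite or infinite set with that convex hull contains \<open>b\<close>.\<close>

lemma irredundant_halfspace_in_lattice:
  fixes B :: "(real^'n) set"
  assumes "finite B" and "lattice_polytope (dual_polytope {y. \<forall>b\<in>B. b \<bullet> y \<le> 1})"
    and b: "b \<in> B" "b \<bullet> y = 1" and less: "\<And>c. c \<in> B - {b} \<Longrightarrow> c \<bullet> y < 1"
  shows "b \<in> integer_lattice"
proof -
  obtain V where V: "V \<subseteq> integer_lattice" "convex hull (insert 0 B) = convex hull V"
    using assms(2) by (auto simp: lattice_polytope_def dual_polytope_halfspaces[OF assms(1)])
  have "convex hull (insert 0 (B - {b})) \<subseteq> {c. y \<bullet> c < 1}"
    using less by (intro hull_minimal convex_halfspace_lt) (auto simp: inner_commute)
  then have "b \<notin> convex hull (insert 0 (B - {b}))"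
    using b(2) by (auto simp: inner_commute)
  then have "b extreme_point_of (convex hull (insert b (insert 0 (B - {b}))))"
    using assms(1) by (intro extreme_point_of_convex_hull_insert) auto
  also have "insert b (insert 0 (B - {b})) = insert 0 B"
    using b(1) by auto
  finally have "b \<in> V"
    unfolding V(2) by (rule extreme_point_of_convex_hull)
  with V(1) show ?thesis by auto
qed

section \<open>Integer bounds on interior lattice points\<close>

text \<open>The ratios \<open>m i / s i\<close> increase strictly. Since \<open>s\<close> is
  nondecreasing, \<open>m\<close> itself must then increase, by at least 1 per step from
  \<open>m 1 \<ge> 1\<close>; this gives the lower bound. The upper bound says that the ratio is
  below 1, which passes from \<open>d\<close> down to \<open>i\<close>.\<close>

lemma interior_lecture_hall_point_bounds:
  fixes m s :: "nat \<Rightarrow> int"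
  assumes s_pos: "\<forall>i\<in>{1..d}. s i > 0" and s_mono: "\<forall>i\<in>{1..<d}. s i \<le> s (i + 1)"
    and m: "0 < m 1" "\<forall>i\<in>{1..<d}. m i * s (i + 1) < m (i + 1) * s i" "m d < s d"
    and i: "i \<in> {1..d}"
  shows "int i \<le> m i" "m i < s i"
proof -
  have "1 \<le> i" "i \<le> d" using i by auto
  from this(1,2) show "int i \<le> m i"
  proof (induction i rule: dec_induct)
    case base
    then show ?case using m(1) by simp
  next
    case (step n)
    have s: "0 < s n" and n: "n \<in> {1..<d}"
      using step s_pos by auto
    have "m n * s n \<le> m n * s (n + 1)"
      using step n s_mono by (intro mult_left_mono) auto
    also have "\<dots> < m (n + 1) * s n"
      using n m(2) by blast
    finally have "m n < m (n + 1)"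
      using s by simp
    then show ?case using step by simp
  qed
  from \<open>i \<le> d\<close> \<open>1 \<le> i\<close> show "m i < s i"
  proof (induction i rule: inc_induct)
    case base
    then show ?case using m(3) by simp
  next
    case (step n)
    have s: "0 < s n" and n: "n \<in> {1..<d}"
      using step s_pos by auto
    have "m n * s (n + 1) < m (n + 1) * s n"
      using n m(2) by blast
    also have "\<dots> < s (n + 1) * s n"
      using step s by (intro mult_strict_right_mono) auto
    finally have "s (n + 1) * m n < s (n + 1) * s n"
      by (simp add: mult.commute)
    moreover have "0 < s (n + 1)"
      using n s_pos by auto
    ultimately show ?case
      by simp
  qed
qed

section \<open>Coordinates and the facet inequalities of the polytope\<close>

definition vector_of_coords :: "(nat \<Rightarrow> real) \<Rightarrow> real^'n::{finite,linorder}" where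
  "vector_of_coords f = (\<chi> j. f (inv_into {1..CARD('n)} nth_index j))"

lemma inj_on_nth_index: "inj_on (nth_index :: nat \<Rightarrow> 'n::{finite,linorder}) {1..CARD('n)}"
  using bij_betw_nth_index by (rule bij_betw_imp_inj_on)

lemma nth_index_surj:
  obtains i where "i \<in> {1..CARD('n)}" "j = (nth_index i :: 'n::{finite,linorder})"
  using bij_betw_nth_index[where 'n = 'n] unfolding bij_betw_def by blast

lemma coord_vector_of_coords [simp]:
  assumes "i \<in> {1..CARD('n::{finite,linorder})}"
  shows "coord (vector_of_coords f :: real^'n::{finite,linorder}) i = f i"
  by (simp only: coord_def vector_of_coords_def vec_lambda_beta inv_into_f_f[OF inj_on_nth_index assms])

lemma integer_lattice_coord_iff:
  fixes x :: "real^'n::{finite,linorder}"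
  shows "x \<in> integer_lattice \<longleftrightarrow> (\<forall>i\<in>{1..CARD('n)}. coord x i \<in> \<int>)"
  unfolding integer_lattice_def coord_def mem_Collect_eq by (metis nth_index_surj)

text \<open>Outer normals of the \<open>d + 1\<close> facets with denominators cleared, so that all
  entries are integers. The two ends come from \<open>0 \<le> coord x 1\<close> and from
  \<open>coord x d \<le> s d\<close>, the others from comparing consecutive ratios.\<close>

definition facet_normal :: "(nat \<Rightarrow> int) \<Rightarrow> nat \<Rightarrow> real^'n::{finite,linorder}" where
  "facet_normal s j =
     (if j = 0 then - axis (nth_index 1) 1
      else if j = CARD('n) then axis (nth_index j) 1
      else of_int (s (j + 1)) *\<^sub>R axis (nth_index j) 1 - of_int (s j) *\<^sub>R axis (nth_index (j + 1)) 1)"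

lemma inner_facet_normal:
  fixes x :: "real^'n::{finite,linorder}"
  shows "facet_normal s j \<bullet> x =
    (if j = 0 then - coord x 1
     else if j = CARD('n) then coord x j
     else of_int (s (j + 1)) * coord x j - of_int (s j) * coord x (j + 1))"
  by (simp add: facet_normal_def inner_diff_left inner_axis' coord_def)

lemma coord_axis:
  assumes "i \<in> {1..CARD('n::{finite,linorder})}" "j \<in> {1..CARD('n)}"
  shows "coord (axis (nth_index j) 1 :: real^'n::{finite,linorder}) i = (if i = j then 1 else 0)"
  using inj_on_eq_iff[OF inj_on_nth_index assms] by (auto simp: coord_def axis_def)

lemma coord_facet_normal:
  assumes "i \<in> {1..CARD('n::{finite,linorder})}" "j \<le> CARD('n)"
  shows "coord (facet_normal s j :: real^'n::{finite,linorder}) i =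
    (if j = 0 then (if i = 1 then -1 else 0)
     else if j = CARD('n) then (if i = j then 1 else 0)
     else if i = j then of_int (s (j + 1))
     else if i = j + 1 then - of_int (s j) else 0)"
proof -
  have uminus: "coord (- x) i = - coord x i"
    and diff: "coord (x - y) i = coord x i - coord y i"
    and scale: "coord (c *\<^sub>R x) i = c * coord x i" for x y :: "(real, 'n) vec" and c
    by (simp_all add: coord_def)
  show ?thesis
    using assms
    by (auto simp: facet_normal_def uminus diff scale coord_axis simp del: One_nat_def)
qed

lemma facet_normal_nonzero:
  assumes "\<forall>i\<in>{1..CARD('n::{finite,linorder})}. s i > 0" "j \<le> CARD('n)"
  shows "(facet_normal s j :: real^'n::{finite,linorder}) \<noteq> 0"
proof
  assume 0: "(facet_normal s j :: (real, 'n) vec) = 0"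
  \<comment> \<open>The coordinate \<open>max 1 j\<close> of the normal is -1 for
    \<open>j = 0\<close>, 1 for \<open>j = d\<close> and \<open>s (j + 1)\<close> otherwise, hence
    never zero.\<close>
  have "coord (facet_normal s j :: (real, 'n) vec) (max 1 j) = 0"
    unfolding 0 by (simp add: coord_def)
  moreover have "max 1 j \<in> {1..CARD('n)}"
    using assms(2) by auto
  moreover have "s (j + 1) \<noteq> 0" if "j < CARD('n)"
    using assms(1)[rule_format, of "j + 1"] that by simp
  ultimately show False
    using assms(2) by (auto simp: coord_facet_normal max_def split: if_splits)
qed

definition facet_bound :: "(nat \<Rightarrow> int) \<Rightarrow> nat \<Rightarrow> nat \<Rightarrow> int" where
  "facet_bound s d j = (if j = d then s d else 0)"

lemma ball_atMost_split_ends: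
  fixes d :: nat
  assumes "1 \<le> d"
  shows "(\<forall>j\<in>{..d}. Q j) \<longleftrightarrow> Q 0 \<and> (\<forall>i\<in>{1..<d}. Q i) \<and> Q d"
proof -
  have "{..d} = insert 0 (insert d {1..<d})"
    using assms by auto
  then show ?thesis by auto
qed

lemma lecture_hall_polytope_halfspaces:
  assumes "\<forall>i\<in>{1..CARD('n::{finite,linorder})}. s i > 0"
  shows "lecture_hall_polytope s =
    {x :: real^'n::{finite,linorder}. \<forall>j\<in>{..CARD('n)}. facet_normal s j \<bullet> x \<le> of_int (facet_bound s CARD('n) j)}"
proof -
  have card: "1 \<le> CARD('n)" "CARD('n) \<noteq> 0" by (simp_all add: Suc_leI)
  have 1: "0 < s 1" and d: "0 < s CARD('n)"
    using assms card by auto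
  have "coord x i / of_int (s i) \<le> coord x (i + 1) / of_int (s (i + 1)) \<longleftrightarrow>
      of_int (s (i + 1)) * coord x i - of_int (s i) * coord x (i + 1) \<le> 0"
    if "i \<in> {1..<CARD('n)}" for i and x :: "(real, 'n) vec"
  proof -
    have "0 < s i" "0 < s (i + 1)"
      using assms that by auto
    then show ?thesis
      by (simp add: divide_simps mult.commute)
  qed
  then show ?thesis
    using 1 d card(2)
    unfolding lecture_hall_polytope_def ball_atMost_split_ends[OF card(1)]
    by (auto simp: inner_facet_normal facet_bound_def zero_le_divide_iff)
qed

lemma interior_lecture_hall_polytope_iff:
  fixes x :: "real^'n::{finite,linorder}"
  assumes "\<forall>i\<in>{1..CARD('n::{finite,linorder})}. s i > 0"
  shows "x \<in> interior (lecture_hall_polytope s) \<longleftrightarrow>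
    0 < coord x 1 \<and>
    (\<forall>i\<in>{1..<CARD('n)}. coord x i * of_int (s (i + 1)) < coord x (i + 1) * of_int (s i)) \<and>
    coord x CARD('n) < of_int (s CARD('n))"
proof -
  have card: "1 \<le> CARD('n)" "CARD('n) \<noteq> 0" by (simp_all add: Suc_leI)
  have "interior (lecture_hall_polytope s) =
    {x :: (real, 'n) vec. \<forall>j\<in>{..CARD('n)}. facet_normal s j \<bullet> x < of_int (facet_bound s CARD('n) j)}"
    unfolding lecture_hall_polytope_halfspaces[OF assms]
    using facet_normal_nonzero[OF assms] by (intro interior_finite_Inter_halfspaces) auto
  then show ?thesis
    using card(2) unfolding ball_atMost_split_ends[OF card(1)]
    by (auto simp: inner_facet_normal facet_bound_def mult.commute)
qed


section \<open>The unique interior lattice point of a Fano translate\<close>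

lemma Diff_frontier_eq_interior: "S - frontier S = interior S"
  using closure_subset[of S] interior_subset[of S] by (auto simp: frontier_def)

lemma lecture_hall_translate_fano:
  fixes v :: "real^'n::{finite,linorder}"
  assumes s_pos: "\<forall>i\<in>{1..CARD('n)}. s i > 0"
    and s_step: "\<forall>i\<in>{1..<CARD('n)}. 0 \<le> s (i + 1) - s i \<and> s (i + 1) - s i \<le> 1"
    and v_lattice: "v \<in> integer_lattice"
    and fano: "fano ((+) v ` lecture_hall_polytope s)"
  shows "v = - vector_of_coords real" (is "v = - ?w")
    and "s CARD('n) = int CARD('n) + 1"
    and "\<forall>i\<in>{1..CARD('n)}. int i < s i"
proof -
  let ?P = "lecture_hall_polytope s :: ((real, 'n) vec) set" and ?d = "CARD('n)"
  have card: "1 \<le> ?d" by (simp add: Suc_leI)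
  have interior: "(+) v ` interior ?P \<inter> integer_lattice = {0}"
    using fano by (simp add: fano_def Diff_frontier_eq_interior interior_translation)
  have v: "- v \<in> interior ?P"
  proof -
    have "0 \<in> (+) v ` interior ?P"
      using interior by blast
    then show ?thesis
      by (metis add_eq_0_iff imageE)
  qed
  \<comment> \<open>Translation by the lattice vector \<open>v\<close> maps interior lattice points
    to interior lattice points, and the only one of the translate is \<open>0\<close>.\<close>
  have unique: "u = - v" if "u \<in> interior ?P" "u \<in> integer_lattice" for u
  proof -
    have "v + u \<in> integer_lattice"
      using v_lattice that(2) by (auto simp: integer_lattice_def)
    then have "v + u = 0"
      using interior that(1) by blast
    then show ?thesis
      by (simp add: eq_neg_iff_add_eq_0 add.commute)
  qed
  \<comment> \<open>The coordinates of \<open>- v\<close> are already integers; the floor only moves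
    them to type \<open>int\<close>, where strict inequalities gain a full unit.\<close>
  define m where "m i = \<lfloor>coord (- v) i\<rfloor>" for i
  have m_eq: "coord (- v) i = of_int (m i)" if "i \<in> {1..?d}" for i
    using v_lattice that by (auto simp: m_def coord_def integer_lattice_def)
  have m1: "0 < m 1"
    using v m_eq[of 1] card by (simp add: interior_lecture_hall_polytope_iff[OF s_pos])
  have md: "m ?d < s ?d"
    using v m_eq[of ?d] card by (simp add: interior_lecture_hall_polytope_iff[OF s_pos])
  have m: "\<forall>i\<in>{1..<?d}. m i * s (i + 1) < m (i + 1) * s i"
  proof
    fix i assume i: "i \<in> {1..<?d}"
    then have "of_int (m i) * of_int (s (i + 1)) < (of_int (m (i + 1)) * of_int (s i) :: real)"
      using v m_eq[of i] m_eq[of "i + 1"] unfolding interior_lecture_hall_polytope_iff[OF s_pos]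
      by (metis add_leD2 atLeastAtMost_iff atLeastLessThan_iff le_add2 less_eq_Suc_le less_imp_le_nat Suc_eq_plus1)
    then show "m i * s (i + 1) < m (i + 1) * s i"
      by (simp only: of_int_mult[symmetric] of_int_less_iff)
  qed
  show less: "\<forall>i\<in>{1..?d}. int i < s i"
    using interior_lecture_hall_point_bounds[OF s_pos _ m1 m md] s_step by force
  \<comment> \<open>A step of \<open>s\<close> is at most 1, so the left side is at most
    \<open>i * s i + i\<close>, and \<open>i < s i\<close>. This is the ratio inequality for the
    point \<open>(1, \<dots>, d)\<close>.\<close>
  have consecutive: "int i * s (i + 1) < (int i + 1) * s i" if "i \<in> {1..<?d}" for i
  proof -
    have "int i * s (i + 1) \<le> int i * (s i + 1)"
      using s_step[rule_format, OF that] by (intro mult_left_mono) auto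
    also have "\<dots> < (int i + 1) * s i"
      using less that by (auto simp: algebra_simps)
    finally show ?thesis .
  qed
  have w: "?w \<in> interior ?P"
    unfolding interior_lecture_hall_polytope_iff[OF s_pos]
  proof (intro conjI ballI)
    fix i assume i: "i \<in> {1..<?d}"
    have "real_of_int (int i * s (i + 1)) < of_int ((int i + 1) * s i)"
      using consecutive[OF i] by (simp only: of_int_less_iff)
    then show "coord ?w i * of_int (s (i + 1)) < coord ?w (i + 1) * of_int (s i)"
      using i by (simp add: add.commute)
  next
    have "real_of_int (int ?d) < of_int (s ?d)"
      using less card by (simp only: of_int_less_iff) auto
    then show "coord ?w ?d < of_int (s ?d)"
      using card by simp
  qed (use card in simp)
  have "?w \<in> integer_lattice"
    by (simp add: integer_lattice_coord_iff)
  with unique[OF w] show "v = - ?w"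
    by simp
  show "s ?d = int ?d + 1"
  proof (rule ccontr)
    assume "s ?d \<noteq> int ?d + 1"
    then have d: "int ?d + 1 < s ?d"
      using less[rule_format, of ?d] card by simp
    \<comment> \<open>Raising only the last coordinate of \<open>?w\<close> by 1 preserves the ratio
      inequalities, and \<open>d + 1 < s d\<close> keeps the upper bound strict. This would be a
      second interior lattice point.\<close>
    let ?u = "vector_of_coords (\<lambda>i. if i = ?d then real i + 1 else real i) :: (real, 'n) vec"
    have "?u \<in> interior ?P"
      unfolding interior_lecture_hall_polytope_iff[OF s_pos]
    proof (intro conjI ballI)
      fix i assume i: "i \<in> {1..<?d}"
      have "real_of_int (int i * s (i + 1)) < of_int ((int i + 1) * s i)"
        using consecutive[OF i] by (simp only: of_int_less_iff)
      also have "real_of_int ((int i + 1) * s i) = real (i + 1) * of_int (s i)"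
        by simp
      also have "\<dots> \<le> coord ?u (i + 1) * of_int (s i)"
        using s_pos[rule_format, of i] i by (intro mult_right_mono) auto
      finally show "coord ?u i * of_int (s (i + 1)) < coord ?u (i + 1) * of_int (s i)"
        using i by simp
    next
      have "real_of_int (int ?d + 1) < of_int (s ?d)"
        using d by (simp only: of_int_less_iff)
      then show "coord ?u ?d < of_int (s ?d)"
        using card by simp
    qed (use card in simp)
    moreover have "?u \<in> integer_lattice"
      by (simp add: integer_lattice_coord_iff)
    ultimately have "?u = ?w"
      using unique \<open>v = - ?w\<close> by simp
    then have "coord ?u ?d = coord ?w ?d"
      by simp
    then show False
      using card by simp
  qed
qed

section \<open>The dual of the centred polytope\<close>

text \<open>The slack of the \<open>j\<close>-th facet inequality at the centre
  \<open>(1, \<dots>, d)\<close>. For \<open>0 < j < d\<close> it is the number \<open>k j\<close>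
  of the theorem.\<close>

definition facet_distance :: "(nat \<Rightarrow> int) \<Rightarrow> nat \<Rightarrow> nat \<Rightarrow> int" where
  "facet_distance s d j =
     (if j = 0 then 1 else if j = d then s d - int d else (int j + 1) * s j - int j * s (j + 1))"

text \<open>Dividing by the slack at the centre normalises the right-hand side of the
  \<open>j\<close>-th inequality to 1 once the centre is moved to the origin.\<close>

definition dual_vertex :: "(nat \<Rightarrow> int) \<Rightarrow> nat \<Rightarrow> real^'n::{finite,linorder}" where
  "dual_vertex s j = facet_normal s j /\<^sub>R of_int (facet_distance s CARD('n) j)"

lemma inner_facet_normal_centre:
  assumes "j \<le> CARD('n)"
  shows "facet_normal s j \<bullet> (vector_of_coords real :: real^'n::{finite,linorder}) =
    of_int (facet_bound s CARD('n) j) - of_int (facet_distance s CARD('n) j)"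
  using assms
  by (auto simp: inner_facet_normal facet_bound_def facet_distance_def Suc_le_eq algebra_simps)

lemma inner_dual_vertex:
  fixes x :: "real^'n::{finite,linorder}"
  assumes "j \<le> CARD('n)" "facet_distance s CARD('n) j \<noteq> 0"
  shows "dual_vertex s j \<bullet> (x - vector_of_coords real) =
    1 + (facet_normal s j \<bullet> x - of_int (facet_bound s CARD('n) j)) / of_int (facet_distance s CARD('n) j)"
  using assms(2)
  by (simp add: dual_vertex_def inner_diff_right inner_facet_normal_centre[OF assms(1)] field_simps)

lemma translated_lecture_hall_polytope_halfspaces:
  assumes s_pos: "\<forall>i\<in>{1..CARD('n::{finite,linorder})}. s i > 0"
    and pos: "\<And>j. j \<le> CARD('n) \<Longrightarrow> 0 < facet_distance s CARD('n) j"
  shows "(+) (- vector_of_coords real) ` lecture_hall_polytope s =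
    {y :: real^'n::{finite,linorder}. \<forall>b\<in>dual_vertex s ` {..CARD('n)}. b \<bullet> y \<le> 1}"
proof -
  let ?w = "vector_of_coords real :: (real, 'n) vec"
  have "x \<in> lecture_hall_polytope s \<longleftrightarrow> (\<forall>b\<in>dual_vertex s ` {..CARD('n)}. b \<bullet> (x - ?w) \<le> 1)"
    for x :: "(real, 'n) vec"
  proof -
    have "facet_normal s j \<bullet> x \<le> of_int (facet_bound s CARD('n) j) \<longleftrightarrow> dual_vertex s j \<bullet> (x - ?w) \<le> 1"
      if "j \<le> CARD('n)" for j
      using that pos[OF that] by (simp add: inner_dual_vertex divide_le_0_iff)
    then show ?thesis
      by (simp add: lecture_hall_polytope_halfspaces[OF s_pos])
  qed
  note iff = this
  show ?thesis
  proof (intro set_eqI iffI)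
    fix y :: "(real, 'n) vec" assume "y \<in> (+) (- ?w) ` lecture_hall_polytope s"
    then obtain x where "x \<in> lecture_hall_polytope s" "y = x - ?w"
      by auto
    then show "y \<in> {y. \<forall>b\<in>dual_vertex s ` {..CARD('n)}. b \<bullet> y \<le> 1}"
      by (simp only: iff mem_Collect_eq)
  next
    fix y :: "(real, 'n) vec" assume "y \<in> {y. \<forall>b\<in>dual_vertex s ` {..CARD('n)}. b \<bullet> y \<le> 1}"
    then have "y + ?w \<in> lecture_hall_polytope s"
      by (simp only: iff mem_Collect_eq add_diff_cancel_right')
    then have "- ?w + (y + ?w) \<in> (+) (- ?w) ` lecture_hall_polytope s"
      by (rule imageI)
    then show "y \<in> (+) (- ?w) ` lecture_hall_polytope s"
      by simp
  qed
qed

text \<open>Supplies the point required by \<open>irredundant_halfspace_in_lattice\<close>: one in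
  the relative interior of the \<open>i\<close>-th facet, where every other facet inequality is
  strict.\<close>

lemma dual_vertex_irredundant:
  assumes s_pos: "\<forall>i\<in>{1..CARD('n::{finite,linorder})}. s i > 0"
    and pos: "\<And>j. j \<le> CARD('n) \<Longrightarrow> 0 < facet_distance s CARD('n) j"
    and i: "i \<in> {1..<CARD('n)}"
  obtains y :: "real^'n::{finite,linorder}"
  where "dual_vertex s i \<bullet> y = 1"
    and "\<And>j. j \<le> CARD('n) \<Longrightarrow> j \<noteq> i \<Longrightarrow> dual_vertex s j \<bullet> y < 1"
proof -
  let ?d = "CARD('n)"
  \<comment> \<open>The ratios \<open>x\<^sub>j / s\<^sub>j\<close> increase by \<open>1 / (d + 1)\<close> at each step except the \<open>i\<close>-th, where they are constant.\<close>
  define q :: "nat \<Rightarrow> real" where "q j = real (if j \<le> i then j else j - 1) / (real ?d + 1)" for j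
  define x where "x = (vector_of_coords (\<lambda>j. of_int (s j) * q j) :: (real, 'n) vec)"
  have x: "coord x j = of_int (s j) * q j" if "j \<in> {1..?d}" for j
    using that by (simp add: x_def)
  have tight: "facet_normal s i \<bullet> x = of_int (facet_bound s ?d i)"
    using i by (simp add: inner_facet_normal facet_bound_def x q_def)
  have strict: "facet_normal s j \<bullet> x < of_int (facet_bound s ?d j)" if j: "j \<le> ?d" "j \<noteq> i" for j
  proof -
    consider "j = 0" | "j = ?d" | "j \<in> {1..<?d}"
      using j(1) by fastforce
    then show ?thesis
    proof cases
      case 1
      then show ?thesis
        using s_pos i by (simp add: inner_facet_normal facet_bound_def x q_def)
    next
      case 2
      \<comment> \<open>Since \<open>i < d\<close>, the last ratio is
        \<open>(d - 1) / (d + 1)\<close>.\<close>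
      have "0 < s ?d" and "q ?d < 1"
        using s_pos i by (auto simp: q_def)
      then show ?thesis
        using i by (simp add: 2 inner_facet_normal facet_bound_def x)
    next
      case 3
      then have "0 < s j" "0 < s (j + 1)"
        using s_pos by auto
      moreover have "q j < q (j + 1)"
        using j 3 by (auto simp: q_def divide_strict_right_mono)
      ultimately have "of_int (s (j + 1)) * of_int (s j) * q j < of_int (s (j + 1)) * of_int (s j) * q (j + 1)"
        by (intro mult_strict_left_mono) auto
      then show ?thesis
        using 3 by (simp add: inner_facet_normal facet_bound_def x algebra_simps)
    qed
  qed
  show thesis
  proof
    show "dual_vertex s i \<bullet> (x - vector_of_coords real) = 1"
      using i pos[of i] tight by (simp add: inner_dual_vertex)
    show "dual_vertex s j \<bullet> (x - vector_of_coords real) < 1" if "j \<le> ?d" "j \<noteq> i" for j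
      using pos[OF that(1)] strict[OF that] that(1) by (simp add: inner_dual_vertex divide_less_0_iff)
  qed
qed

text \<open>The only coordinates that can be nonzero are \<open>s (i + 1) / k\<close> at
  \<open>i\<close> and \<open>- s i / k\<close> at \<open>i + 1\<close>, so integrality is exactly
  the pair of divisibilities.\<close>

lemma dual_vertex_in_lattice_iff:
  assumes i: "i \<in> {1..<CARD('n::{finite,linorder})}"
    and k: "k = (int i + 1) * s i - int i * s (i + 1)" "0 < k"
  shows "(dual_vertex s i :: real^'n::{finite,linorder}) \<in> integer_lattice \<longleftrightarrow> k dvd s i \<and> k dvd s (i + 1)"
proof -
  let ?b = "dual_vertex s i :: (real, 'n) vec"
  have coord: "coord ?b j =
      (if j = i then of_int (s (i + 1)) / of_int k else if j = i + 1 then of_int (- s i) / of_int k else 0)"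
    if "j \<in> {1..CARD('n)}" for j
  proof -
    have "coord ?b j = coord (facet_normal s i :: (real, 'n) vec) j / of_int k"
      using i k(1) by (auto simp: dual_vertex_def facet_distance_def coord_def divide_inverse_commute)
    then show ?thesis
      using i that by (auto simp: coord_facet_normal)
  qed
  have "?b \<in> integer_lattice \<longleftrightarrow> coord ?b i \<in> \<int> \<and> coord ?b (i + 1) \<in> \<int>"
    using i coord unfolding integer_lattice_coord_iff by auto
  also have "\<dots> \<longleftrightarrow> k dvd s (i + 1) \<and> k dvd - s i"
    using i k(2) coord[of i] coord[of "i + 1"] of_int_divide_in_Ints_iff[of k, where 'a = real]
    by simp
  finally show ?thesis
    by auto
qed

text \<open>The slack at facet \<open>0\<close> is 1, and \<open>s d = d + 1\<close> makes the slack
  at facet \<open>d\<close> equal to 1 as well, so both end normals stay integral.\<close>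

lemma dual_vertex_ends_in_lattice:
  assumes "s CARD('n::{finite,linorder}) = int CARD('n) + 1"
  shows "(dual_vertex s 0 :: real^'n::{finite,linorder}) \<in> integer_lattice"
    and "(dual_vertex s CARD('n) :: real^'n::{finite,linorder}) \<in> integer_lattice"
  using assms by (auto simp: dual_vertex_def facet_distance_def facet_normal_def integer_lattice_def axis_def)

section \<open>Reflexivity as integrality of the dual vertices\<close>

theorem theorem2p9:
  fixes s :: "nat \<Rightarrow> int"
    and P :: "(real^'n::{finite,linorder}) set"
    and k :: "nat \<Rightarrow> int"
  defines "P \<equiv> lecture_hall_polytope s"
    and "k \<equiv> \<lambda>i. (int i + 1) * s i - int i * s (i + 1)"
  assumes s_pos: "\<forall>i\<in>{1..CARD('n)}. s i > 0"
    and s_mono: "\<forall>i\<in>{1..<CARD('n)}. s i \<le> s (i + 1)"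
    and s_step: "\<forall>i\<in>{1..<CARD('n)}. 0 \<le> s (i + 1) - s i \<and> s (i + 1) - s i \<le> 1"
    and fano: "\<exists>Q. fano Q \<and> translation_equivalent P Q"
  shows "reflexive_up_to_translation P \<longleftrightarrow>
    (\<forall>i\<in>{1..<CARD('n)}. k i dvd s i \<and> k i dvd s (i + 1))"
proof -
  let ?d = "CARD('n)" and ?w = "vector_of_coords real :: (real, 'n) vec"
  let ?B = "dual_vertex s ` {..?d} :: (real, 'n) vec set" and ?Q = "(+) (- ?w) ` P"
  have card: "1 \<le> ?d" by (simp add: Suc_leI)
  have P: "P = lecture_hall_polytope s" by (simp add: P_def)
  \<comment> \<open>At most one lattice translate is Fano, so reflexivity up to translation becomes
    a condition on the dual of the single polytope \<open>?Q\<close>.\<close>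
  have only: "v = - ?w" if "v \<in> integer_lattice" "Defs.fano ((+) v ` P)" for v :: "(real, 'n) vec"
    using lecture_hall_translate_fano(1)[OF s_pos s_step] that P by simp
  obtain v where v: "v \<in> integer_lattice" "Defs.fano ((+) v ` P)"
    using fano by (auto simp: translation_equivalent_def)
  have w: "- ?w \<in> integer_lattice" "Defs.fano ?Q"
    using v only[OF v] by auto
  note s_last = lecture_hall_translate_fano(2)[OF s_pos s_step v[unfolded P]]
    and s_gt = lecture_hall_translate_fano(3)[OF s_pos s_step v[unfolded P], rule_format]
  \<comment> \<open>Here \<open>k i = s i - i * (s (i + 1) - s i)\<close>, which is at least
    \<open>s i - i\<close> and hence positive.\<close>
  have k_pos: "0 < k i" if i: "i \<in> {1..<?d}" for i
  proof -
    have "int i * s (i + 1) \<le> int i * (s i + 1)"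
      using s_step[rule_format, OF i] by (intro mult_left_mono) auto
    then show ?thesis
      using s_gt[of i] i by (simp add: k_def algebra_simps)
  qed
  have pos: "0 < facet_distance s ?d j" if "j \<le> ?d" for j
    using that k_pos[of j] s_last card by (auto simp: facet_distance_def k_def)
  have Q: "?Q = {y. \<forall>b\<in>?B. b \<bullet> y \<le> 1}"
    unfolding P by (rule translated_lecture_hall_polytope_halfspaces[OF s_pos pos])
  have lattice_iff: "(dual_vertex s i :: (real, 'n) vec) \<in> integer_lattice \<longleftrightarrow> k i dvd s i \<and> k i dvd s (i + 1)"
    if "i \<in> {1..<?d}" for i
    using that k_pos[OF that] by (intro dual_vertex_in_lattice_iff) (simp_all add: k_def)
  have "reflexive_up_to_translation P \<longleftrightarrow> lattice_polytope (dual_polytope ?Q)"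
  proof
    assume "reflexive_up_to_translation P"
    then obtain v where "v \<in> integer_lattice" "reflexive ((+) v ` P)"
      unfolding reflexive_up_to_translation_def translation_equivalent_def by blast
    with only show "lattice_polytope (dual_polytope ?Q)"
      unfolding reflexive_def by blast
  next
    assume "lattice_polytope (dual_polytope ?Q)"
    with w show "reflexive_up_to_translation P"
      unfolding reflexive_up_to_translation_def translation_equivalent_def reflexive_def by blast
  qed
  also have "\<dots> \<longleftrightarrow> (\<forall>i\<in>{1..<?d}. k i dvd s i \<and> k i dvd s (i + 1))"
  proof
    assume L: "lattice_polytope (dual_polytope ?Q)"
    show "\<forall>i\<in>{1..<?d}. k i dvd s i \<and> k i dvd s (i + 1)"
    proof
      fix i assume i: "i \<in> {1..<?d}"
      obtain y :: "(real, 'n) vec" where y: "dual_vertex s i \<bullet> y = 1"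
        "\<And>j. j \<le> ?d \<Longrightarrow> j \<noteq> i \<Longrightarrow> dual_vertex s j \<bullet> y < 1"
        using dual_vertex_irredundant[OF s_pos pos i] by blast
      have "(dual_vertex s i :: (real, 'n) vec) \<in> integer_lattice"
      proof (rule irredundant_halfspace_in_lattice)
        show "lattice_polytope (dual_polytope {y. \<forall>b\<in>?B. b \<bullet> y \<le> 1})"
          using L by (simp only: Q)
      qed (use i y in auto)
      then show "k i dvd s i \<and> k i dvd s (i + 1)"
        using lattice_iff[OF i] by simp
    qed
  next
    assume dvd: "\<forall>i\<in>{1..<?d}. k i dvd s i \<and> k i dvd s (i + 1)"
    \<comment> \<open>Divisibility handles the inner indices and \<open>s d = d + 1\<close> the two
      ends, so all generators of the dual are lattice points.\<close>
    have "\<forall>j\<in>{..?d}. (dual_vertex s j :: (real, 'n) vec) \<in> integer_lattice"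
      unfolding ball_atMost_split_ends[OF card]
      using dvd lattice_iff s_last card dual_vertex_ends_in_lattice[of s, where 'n = 'n] by auto
    then have "insert 0 ?B \<subseteq> integer_lattice"
      by (auto simp: integer_lattice_def)
    moreover have "dual_polytope ?Q = convex hull (insert 0 ?B)"
      unfolding Q by (intro dual_polytope_halfspaces) simp
    ultimately show "lattice_polytope (dual_polytope ?Q)"
      unfolding lattice_polytope_def by (metis finite_atMost finite_imageI finite_insert)
  qed
  finally show ?thesis .
qed

end
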